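(* For every integer $k \ge 3$ there exists a constant $c=c(k)>0$ such that for all sufficiently large $n$, $$f_k(n) \ge (1+c)\binom{n-1}{k-1}.$$
   Context: For integers $k\ge 2$ and $\ell \ge k+1$, the tight $k$-uniform $\ell$-cycle $TC_\ell^k$ is the $k$-uniform hypergraph on $\ell$ distinct vertices $v_0,\dots,v_{\ell-1}$ whose edges are all the $k$-sets $\{v_i,v_{i+1},\dots,v_{i+k-1}\}$, $i=0,\dots,\ell-1$, with subscripts taken modulo $\ell$. A $k$-uniform hypergraph is tight-cycle-free if it contains no subhypergraph isomorphic to $TC_\ell^k$ for any $\ell\ge k+1$. $f_k(n)$ denotes the maximum number of edges in a tight-cycle-free $k$-uniform hypergraph on $n$ vertices. *)

theory Defs
  imports Complex_Main
begin

text \<open>A hypergraph is a pair of a vertex set and a set of edges.\<close>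

type_synonym 'a hypergraph = "'a set \<times> 'a set set"

abbreviation vertices :: "'a hypergraph \<Rightarrow> 'a set" where
  "vertices H \<equiv> fst H"

abbreviation edges :: "'a hypergraph \<Rightarrow> 'a set set" where
  "edges H \<equiv> snd H"

definition uniform_hypergraph :: "nat \<Rightarrow> 'a hypergraph \<Rightarrow> bool" where
  "uniform_hypergraph k H \<longleftrightarrow>
     finite (vertices H) \<and> (\<forall>e\<in>edges H. e \<subseteq> vertices H \<and> card e = k)"

definition subhypergraph :: "'a hypergraph \<Rightarrow> 'a hypergraph \<Rightarrow> bool" where
  "subhypergraph H' H \<longleftrightarrow>
     vertices H' \<subseteq> vertices H \<and> edges H' \<subseteq> edges H \<and> (\<forall>e\<in>edges H'. e \<subseteq> vertices H')"

definition hypergraph_iso :: "'a hypergraph \<Rightarrow> 'b hypergraph \<Rightarrow> bool" where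
  "hypergraph_iso G H \<longleftrightarrow>
     (\<exists>f. bij_betw f (vertices G) (vertices H) \<and> (\<lambda>e. f ` e) ` edges G = edges H)"

text \<open>The tight cycle, with the number \<open>i\<close> playing the role of the vertex \<open>v\<^sub>i\<close>;
  intended for \<open>2 \<le> k < l\<close>.\<close>

definition tight_cycle :: "nat \<Rightarrow> nat \<Rightarrow> nat hypergraph" where
  "tight_cycle k l = ({..<l}, {{(i + j) mod l | j. j < k} | i. i < l})"

definition tight_cycle_free :: "nat \<Rightarrow> 'a hypergraph \<Rightarrow> bool" where
  "tight_cycle_free k H \<longleftrightarrow>
     \<not> (\<exists>l H'. l \<ge> k + 1 \<and> subhypergraph H' H \<and> hypergraph_iso (tight_cycle k l) H')"

definition edge_counts :: "nat \<Rightarrow> nat \<Rightarrow> nat set" where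
  "edge_counts k n =
     {card (edges H) | H :: nat hypergraph.
        uniform_hypergraph k H \<and> card (vertices H) = n \<and> tight_cycle_free k H}"

text \<open>Vertices are natural numbers, which loses nothing since every finite hypergraph has
  an isomorphic copy on them. The maximum is attained: see the next two lemmas.\<close>

definition max_tight_cycle_free :: "nat \<Rightarrow> nat \<Rightarrow> nat" where
  "max_tight_cycle_free k n = Max (edge_counts k n)"

lemma finite_edge_counts: "finite (edge_counts k n)"
proof (rule finite_subset)
  show "edge_counts k n \<subseteq> {..n choose k}"
  proof
    fix m assume "m \<in> edge_counts k n"
    then obtain H :: "nat hypergraph" where H: "uniform_hypergraph k H"
      "card (vertices H) = n" "m = card (edges H)"
      unfolding edge_counts_def by blast
    have fin: "finite (vertices H)"
      and sub: "edges H \<subseteq> {e. e \<subseteq> vertices H \<and> card e = k}"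
      using H(1) unfolding uniform_hypergraph_def by auto
    have "card (edges H) \<le> card {e. e \<subseteq> vertices H \<and> card e = k}"
      using fin sub by (intro card_mono) auto
    also have "\<dots> = n choose k"
      using n_subsets[OF fin] H(2) by simp
    finally show "m \<in> {..n choose k}" using H(3) by simp
  qed
qed simp

lemma edge_counts_nonempty: "edge_counts k n \<noteq> {}"
proof -
  have "tight_cycle_free k ({..<n}, {})"
    unfolding tight_cycle_free_def subhypergraph_def hypergraph_iso_def tight_cycle_def
    by (auto dest: spec[of _ 0])
  then have "card (edges ({..<n}, {} :: nat set set)) \<in> edge_counts k n"
    unfolding edge_counts_def uniform_hypergraph_def
    by (intro CollectI exI[of _ "({..<n}, {})"]) simp
  then show ?thesis by blast
qed

end

theory Submission
  imports Defs "HOL-Number_Theory.Cong"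
begin

text \<open>
  Arrange the vertices in \<open>t\<close> blocks of five rows of length \<open>m\<close>. An edge consists of a vertex
  \<open>y\<close> in row 0 or 1 and a vertex \<open>z\<close> in row 2, 3 or 4 of the same block, and \<open>k - 2\<close> vertices \<open>T\<close> of
  higher blocks, such that \<open>y + h \<equiv> z\<close> modulo \<open>m\<close>, where \<open>h\<close> is one of two numbers attached to
  \<open>max T\<close>, selected by the row of \<open>y\<close>. Each \<open>T\<close> above a block extends to \<open>6 m\<close> edges while
  the block has \<open>5 m\<close> vertices, so the edges outnumber the \<open>(k - 1)\<close>-sets by a factor close to 6/5
  when \<open>t\<close> is large.

  Along a tight cycle the block of \<open>y\<close> and \<open>z\<close> is constant, and \<open>y\<close>, \<open>z\<close> are replaced once in every \<open>k\<close>
  steps, a \<open>y\<close> by a \<open>y\<close> and a \<open>z\<close> by a \<open>z\<close>. Since \<open>T\<close> is kept when \<open>y\<close> is replaced, the row of \<open>y\<close>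
  alternates; since \<open>y\<close> and \<open>T\<close> are kept when \<open>z\<close> is replaced, the residue of
  \<open>z\<close> modulo \<open>m\<close> never changes, so \<open>z\<close> takes at most three values. Hence \<open>y\<close> and \<open>z\<close> take two values each, and
  both numbers attached to \<open>max T\<close> are constant. As they determine \<open>max T\<close>, this vertex would lie in
  two disjoint segments of the cycle.
\<close>

section \<open>Splitting an edge into its lowest pair and its tail\<close>

definition pointed :: "('a \<Rightarrow> nat) \<Rightarrow> ('a \<Rightarrow> bool) \<Rightarrow> 'a \<Rightarrow> 'a \<Rightarrow> 'a set \<Rightarrow> bool" where
  "pointed b P y z T \<longleftrightarrow> b y = b z \<and> P y \<and> \<not> P z \<and> (\<forall>u\<in>T. b y < b u)"

lemma pointed_notin:
  assumes "pointed b P y z T"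
  shows "y \<noteq> z" "y \<notin> T" "z \<notin> T"
  using assms unfolding pointed_def by force+

lemma pointed_low:
  assumes "pointed b P y z T"
  shows "{w \<in> insert y (insert z T). b w = b y} = {y, z}"
    and "{w \<in> insert y (insert z T). b w \<noteq> b y} = T"
  using assms unfolding pointed_def by force+

text \<open>The elements of least \<open>b\<close>-value are exactly \<open>y\<close> and
  \<open>z\<close>, and \<open>P\<close> tells them apart.\<close>

lemma pointed_unique:
  assumes p: "pointed b P y z T" and p': "pointed b P y' z' T'"
    and eq: "insert y' (insert z' T') = insert y (insert z T)"
  shows "y' = y" "z' = z" "T' = T"
proof -
  have le: "b y \<le> b w" if "w \<in> insert y (insert z T)" for w
    using p that unfolding pointed_def by force
  have le': "b y' \<le> b w" if "w \<in> insert y' (insert z' T')" for w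
    using p' that unfolding pointed_def by force
  have b: "b y' = b y"
    using le[of y'] le'[of y] eq by force
  have "{y', z'} = {y, z}" and T: "T' = T"
    using pointed_low[OF p] pointed_low[OF p'] eq b by auto
  then show "y' = y" "z' = z" "T' = T"
    using p p' unfolding pointed_def by (auto simp: doubleton_eq_iff)
qed

text \<open>One of \<open>y\<close>, \<open>z\<close> survives, so the least value cannot rise; only
  \<open>v\<close> could lie below it, but the lowest level holds two elements, so it cannot drop.
  With the level fixed, \<open>P\<close> identifies the new pair.\<close>

lemma pointed_exchange:
  assumes p: "pointed b P y z T" and p': "pointed b P y' z' T'"
    and eq: "insert y' (insert z' T') = insert v (insert y (insert z T) - {u})"
    and v: "v \<notin> insert y (insert z T)" and u: "u \<in> insert y (insert z T)"
  shows "b y' = b y"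
    and "u = y \<Longrightarrow> y' = v \<and> z' = z \<and> T' = T"
    and "u = z \<Longrightarrow> y' = y \<and> z' = v \<and> T' = T"
    and "u \<in> T \<Longrightarrow> y' = y \<and> z' = z"
proof -
  define W' where "W' = insert v (insert y (insert z T) - {u})"
  note n = pointed_notin[OF p] and n' = pointed_notin[OF p']
  obtain s where s: "s \<in> {y, z}" "s \<noteq> u"
    using n by blast
  have sW: "s \<in> W'"
    using s unfolding W'_def by blast
  have sb: "b s = b y"
    using s p unfolding pointed_def by auto
  have eq': "W' = insert y' (insert z' T')"
    using eq unfolding W'_def ..
  have ge': "b y' \<le> b w" if "w \<in> W'" for w
    using p' that unfolding eq' pointed_def by force
  have ge: "b y \<le> b w" if "w \<in> insert y (insert z T)" for w
    using p that unfolding pointed_def by force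
  have le: "b y' \<le> b y"
    using ge'[OF sW] sb by simp
  have yz': "y' \<in> W'" "z' \<in> W'" "b z' = b y'"
    using p' unfolding eq' pointed_def by auto
  show b: "b y' = b y"
  proof (rule ccontr)
    assume "b y' \<noteq> b y"
    then have "b y' < b y" "b z' < b y" using le yz' by auto
    then have "y' = v" "z' = v"
      using yz'(1,2) ge[of y'] ge[of z'] unfolding W'_def by (meson DiffE insertE leD)+
    then show False using n' by simp
  qed
  have low: "{w \<in> W'. b w = b y} = {y', z'}" and T': "{w \<in> W'. b w \<noteq> b y} = T'"
    using pointed_low[OF p'] unfolding eq' b .
  have P: "P y" "\<not> P z" "P y'" "\<not> P z'" "b z = b y"
    using p p' unfolding pointed_def by auto
  have bT: "b w \<noteq> b y" if "w \<in> T" for w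
    using p that unfolding pointed_def by auto
  \<comment> \<open>Otherwise \<open>s\<close> would be alone on the lowest level of the new
    edge.\<close>
  have vb: "b v = b y" if "u = y \<or> u = z"
  proof (rule ccontr)
    assume "b v \<noteq> b y"
    then have "w = s" if "w \<in> W'" "b w = b y" for w
      using that \<open>u = y \<or> u = z\<close> s bT[of w] unfolding W'_def by blast
    then have "y' = s" "z' = s" using low by blast+
    then show False using n' by simp
  qed
  show "y' = v \<and> z' = z \<and> T' = T" if "u = y"
  proof -
    have "{w \<in> W'. b w = b y} = {v, z}" "{w \<in> W'. b w \<noteq> b y} = T"
      using that vb P(5) n bT unfolding W'_def by blast+
    then show ?thesis using low T' P by (auto simp: doubleton_eq_iff)
  qed
  show "y' = y \<and> z' = v \<and> T' = T" if "u = z"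
  proof -
    have "{w \<in> W'. b w = b y} = {v, y}" "{w \<in> W'. b w \<noteq> b y} = T"
      using that vb P(5) n bT unfolding W'_def by blast+
    then show ?thesis using low T' P by (auto simp: doubleton_eq_iff)
  qed
  show "y' = y \<and> z' = z" if "u \<in> T"
  proof -
    have "y \<in> {w \<in> W'. b w = b y}" "z \<in> {w \<in> W'. b w = b y}"
      using that P(5) n unfolding W'_def by auto
    then have "y \<in> {y', z'}" "z \<in> {y', z'}" using low by auto
    then show ?thesis using P by auto
  qed
qed

section \<open>Coordinates and the congruence behind the edges\<close>

definition block :: "nat \<Rightarrow> nat \<Rightarrow> nat" where
  "block m v = v div m div 5"

definition row :: "nat \<Rightarrow> nat \<Rightarrow> nat" where
  "row m v = v div m mod 5"

definition code :: "nat \<Rightarrow> nat \<Rightarrow> nat \<Rightarrow> nat" where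
  "code m r x = (if r = 0 then x else x div m)"

definition linked :: "nat \<Rightarrow> nat \<Rightarrow> nat \<Rightarrow> nat set \<Rightarrow> bool" where
  "linked m y z T \<longleftrightarrow> pointed (block m) (\<lambda>v. row m v < 2) y z T \<and>
     [y + code m (row m y) (Max T) = z] (mod m)"

lemma coordinates_inject:
  assumes "block m v = block m w" "row m v = row m w" "[v = w] (mod m)"
  shows "v = w"
proof -
  have "v div m = w div m"
    using assms(1,2) unfolding block_def row_def by (metis mult_div_mod_eq)
  then show ?thesis
    using assms(3) unfolding cong_def by (metis mult_div_mod_eq)
qed

text \<open>Below \<open>m * m\<close>, the two codes are the two base-\<open>m\<close> digits once reduced modulo \<open>m\<close>.\<close>

lemma code_inject:
  assumes "x < m * m" "x' < m * m"
    and "[code m 0 x = code m 0 x'] (mod m)" "[code m 1 x = code m 1 x'] (mod m)"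
  shows "x = x'"
proof -
  have "x div m < m" "x' div m < m"
    using assms(1,2) by (simp_all add: less_mult_imp_div_less)
  then have "x div m = x' div m"
    using assms(4) unfolding code_def cong_def by simp
  moreover have "x mod m = x' mod m"
    using assms(3) unfolding code_def cong_def by simp
  ultimately show ?thesis by (metis mult_div_mod_eq)
qed

section \<open>Walks around a tight cycle\<close>

text \<open>The \<open>l\<close>-periodic walk \<open>v\<close> around a tight cycle, with the edge starting at \<open>v i\<close> split into
  \<open>y i\<close>, \<open>z i\<close> and \<open>T i\<close>.\<close>

locale tight_cycle_walk =
  fixes m k l :: nat and v y z :: "nat \<Rightarrow> nat" and T :: "nat \<Rightarrow> nat set"
  assumes window: "v ` {i..<i + k} = insert (y i) (insert (z i) (T i))"
    and linked: "linked m (y i) (z i) (T i)"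
    and v_eq_iff: "v i = v j \<longleftrightarrow> i mod l = j mod l"
    and v_less: "v i < m * m"
    and k: "3 \<le> k" "k < l"
    and card_T: "card (T i) = k - 2"
begin

lemma v_shift: "v (i + d) = v i \<longleftrightarrow> l dvd d"
  using mod_eq_dvd_iff_nat[of i "i + d" l] by (simp add: v_eq_iff)

lemma v_near:
  assumes "i < j" "j \<le> i + k"
  shows "v i \<noteq> v j"
proof
  assume "v i = v j"
  then have "l dvd j - i"
    using v_shift[of i "j - i"] assms by simp
  then have "l \<le> j - i"
    using assms(1) by (simp add: dvd_imp_le)
  then show False using assms(2) k by simp
qed

lemma pointed: "pointed (block m) (\<lambda>v. row m v < 2) (y i) (z i) (T i)"
  using linked[of i] unfolding linked_def by (rule conjunct1)

text \<open>As \<open>k < l\<close>, any \<open>k + 1\<close> consecutive vertices are distinct.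
  This brings neighbouring windows into the form that \<open>pointed_exchange\<close>
  expects.\<close>

lemma window_Suc:
  "insert (y (Suc i)) (insert (z (Suc i)) (T (Suc i))) =
     insert (v (i + k)) (insert (y i) (insert (z i) (T i)) - {v i})"
  "v (i + k) \<notin> insert (y i) (insert (z i) (T i))"
  "v i \<in> insert (y i) (insert (z i) (T i))"
proof -
  have "v (i + k) \<noteq> v j" if "j \<in> {i..<i + k}" for j :: nat
    using v_near[of j "i + k"] that by force
  then show "v (i + k) \<notin> insert (y i) (insert (z i) (T i))"
    unfolding window[symmetric] by blast
  have "i \<in> {i..<i + k}"
    using k by simp
  then show "v i \<in> insert (y i) (insert (z i) (T i))"
    unfolding window[symmetric] by (rule imageI)
  have "inj_on v {i..<i + k}"
    by (rule linorder_inj_onI') (simp add: v_near)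
  then have "v ` ({i..<i + k} - {i}) = v ` {i..<i + k} - v ` {i}"
    using \<open>i \<in> {i..<i + k}\<close> by (intro inj_on_image_set_diff) auto
  then have "v ` ({i..<i + k} - {i}) = v ` {i..<i + k} - {v i}"
    by (simp only: image_insert image_empty)
  moreover have "{Suc i..<Suc i + k} = insert (i + k) ({i..<i + k} - {i})"
    using k by auto
  ultimately have "v ` {Suc i..<Suc i + k} = insert (v (i + k)) (v ` {i..<i + k} - {v i})"
    by (simp only: image_insert)
  then show "insert (y (Suc i)) (insert (z (Suc i)) (T (Suc i))) =
     insert (v (i + k)) (insert (y i) (insert (z i) (T i)) - {v i})"
    unfolding window .
qed

lemmas exchange = pointed_exchange[OF pointed pointed window_Suc]

lemma stay:
  assumes "v i \<noteq> y i" "v i \<noteq> z i"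
  shows "y (Suc i) = y i" "z (Suc i) = z i"
  using exchange(4)[of i] window_Suc(3)[of i] assms by auto

lemma stay_y: "v i \<noteq> y i \<Longrightarrow> y (Suc i) = y i"
  using exchange(3)[of i] stay[of i] by blast

lemma stay_z: "v i \<noteq> z i \<Longrightarrow> z (Suc i) = z i"
  using exchange(2)[of i] stay[of i] by blast

text \<open>Only the first vertex of a window leaves it, and by \<open>v_near\<close> this is not
  \<open>v (i + p)\<close> before time \<open>i + p\<close>.\<close>

lemma keep_y:
  assumes "y i = v (i + p)" "j \<le> p" "p \<le> k"
  shows "y (i + j) = v (i + p)"
  using \<open>j \<le> p\<close>
proof (induction j)
  case (Suc j)
  then have "y (i + j) = v (i + p)" "v (i + j) \<noteq> v (i + p)"
    using v_near[of "i + j" "i + p"] \<open>p \<le> k\<close> by auto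
  then show ?case using stay_y[of "i + j"] by simp
qed (use assms in simp)

lemma keep_z:
  assumes "z i = v (i + p)" "j \<le> p" "p \<le> k"
  shows "z (i + j) = v (i + p)"
  using \<open>j \<le> p\<close>
proof (induction j)
  case (Suc j)
  then have "z (i + j) = v (i + p)" "v (i + j) \<noteq> v (i + p)"
    using v_near[of "i + j" "i + p"] \<open>p \<le> k\<close> by auto
  then show ?case using stay_z[of "i + j"] by simp
qed (use assms in simp)

lemma block_y: "block m (y i) = block m (y 0)"
  by (induction i) (use exchange(1) in auto)

text \<open>A turn of \<open>k\<close> steps exchanges \<open>y\<close> at time \<open>i\<close> and
  \<open>z\<close> at time \<open>i + q\<close>, and neither exchange alters the tail. Across the
  first, both values of \<open>y\<close> satisfy the congruence with the same \<open>T i\<close> and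
  \<open>z\<close>; across the second, the left side is fixed, so \<open>z\<close> keeps its
  residue.\<close>

lemma round:
  assumes y: "y i = v i" and z: "z i = v (i + q)" and q: "0 < q" "q < k"
  shows "y (i + k) = v (i + k)" "z (i + k) = v (i + k + q)"
    and "[v (i + k + q) = v (i + q)] (mod m)"
    and "[v i + code m (row m (v i)) (Max (T i)) = v (i + q)] (mod m)"
    and "[v (i + k) + code m (row m (v (i + k))) (Max (T i)) = v (i + q)] (mod m)"
proof -
  have 1: "y (Suc i) = v (i + k)" "z (Suc i) = v (i + q)" "T (Suc i) = T i"
    using exchange(2)[of i] y z by auto
  have y1: "y (Suc i + j) = v (i + k)" if "j \<le> k - 1" for j
    using keep_y[of "Suc i" "k - 1" j] 1 that k by simp
  have z1: "z (Suc i + j) = v (i + q)" if "j \<le> q - 1" for j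
    using keep_z[of "Suc i" "q - 1" j] 1 that q by simp
  have 2: "y (i + q) = v (i + k)" "z (i + q) = v (i + q)"
    using y1[of "q - 1"] z1[of "q - 1"] q by auto
  have 3: "y (Suc (i + q)) = v (i + k)" "z (Suc (i + q)) = v (i + q + k)" "T (Suc (i + q)) = T (i + q)"
    using exchange(3)[of "i + q"] 2 by auto
  show "y (i + k) = v (i + k)"
    using y1[of "k - 1"] k by simp
  show "z (i + k) = v (i + k + q)"
    using keep_z[of "Suc (i + q)" "k - 1" "k - 1 - q"] 3 q by (simp add: add_ac)
  have c: "[y j + code m (row m (y j)) (Max (T j)) = z j] (mod m)" for j
    using linked[of j] unfolding linked_def by blast
  show "[v i + code m (row m (v i)) (Max (T i)) = v (i + q)] (mod m)"
    using c[of i] y z by simp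
  show "[v (i + k) + code m (row m (v (i + k))) (Max (T i)) = v (i + q)] (mod m)"
    using c[of "Suc i"] 1 by simp
  have "[v (i + k) + code m (row m (v (i + k))) (Max (T (i + q))) = v (i + q)] (mod m)"
    "[v (i + k) + code m (row m (v (i + k))) (Max (T (i + q))) = v (i + q + k)] (mod m)"
    using c[of "i + q"] c[of "Suc (i + q)"] 2 3 by simp_all
  then show "[v (i + k + q) = v (i + q)] (mod m)"
    by (metis cong_sym cong_trans add.assoc add.commute)
qed

lemma contradiction_at_zero:
  assumes y0: "y 0 = v 0"
  shows False
proof -
  obtain q where q: "z 0 = v q" "q < k"
    using window[of 0] by (metis add_0 atLeastLessThan_iff imageE insertCI)
  have q0: "0 < q"
    using q y0 pointed_notin(1)[OF pointed, of 0] by (cases q) auto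
  have yz: "y (n * k) = v (n * k) \<and> z (n * k) = v (n * k + q)" for n
  proof (induction n)
    case (Suc n)
    then show ?case
      using round[of "n * k" q] q q0 by (simp add: add_ac)
  qed (use y0 q in simp)
  note round = round[OF conjunct1[OF yz] conjunct2[OF yz] q0 q(2)]
  have row_y: "row m (v (n * k)) < 2" and row_z: "row m (v (n * k + q)) \<ge> 2"
    and block: "block m (v (n * k)) = block m (v 0)" "block m (v (n * k + q)) = block m (v 0)" for n
    using pointed[of "n * k"] yz[of n] block_y[of "n * k"] y0 unfolding pointed_def by auto
  have z_cong: "[v (n * k + q) = v q] (mod m)" for n
  proof (induction n)
    case (Suc n)
    then show ?case using cong_trans[OF round(3)[of n]] by (simp add: add_ac)
  qed simp
  have l_not_dvd: "\<not> l dvd k"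
    using k by (auto dest: dvd_imp_le)
  \<comment> \<open>In equal rows both vertices would get the same shift from the same tail, hence
    have equal residues and coincide, although \<open>l\<close> does not divide
    \<open>k\<close>.\<close>
  have row_alt: "row m (v (n * k)) \<noteq> row m (v (n * k + k))" for n
  proof
    assume r: "row m (v (n * k)) = row m (v (n * k + k))"
    have "[v (n * k) = v (n * k + k)] (mod m)"
      using cong_trans[OF round(4)[of n] cong_sym[OF round(5)[of n]]] r
      by (simp add: cong_add_rcancel_nat)
    then have "v (n * k) = v (n * k + k)"
      using coordinates_inject r block(1)[of n] block(1)[of "Suc n"] by (metis add.commute mult_Suc)
    then show False
      using v_shift[of "n * k" k] l_not_dvd by simp
  qed
  \<comment> \<open>Pigeonhole: four values of \<open>z\<close> share block and residue and have
    only rows 2, 3 and 4 to occupy. A coincidence makes \<open>l\<close> divide \<open>k\<close>,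
    \<open>2 * k\<close> or \<open>3 * k\<close>.\<close>
  have "\<exists>i<4. \<exists>j<4. i < j \<and> v (i * k + q) = v (j * k + q)"
  proof (rule ccontr)
    assume no: "\<not> ?thesis"
    have "inj_on (\<lambda>i. row m (v (i * k + q))) {..<4::nat}"
    proof (rule inj_onI)
      fix i j :: nat
      assume ij: "i \<in> {..<4}" "j \<in> {..<4}" "row m (v (i * k + q)) = row m (v (j * k + q))"
      then have "v (i * k + q) = v (j * k + q)"
        using coordinates_inject block(2) cong_trans[OF z_cong cong_sym[OF z_cong]] by metis
      then show "i = j" using no ij(1,2) by (metis lessThan_iff nat_neq_iff)
    qed
    moreover have "(\<lambda>i. row m (v (i * k + q))) ` {..<4} \<subseteq> {2..<5}"
      using row_z by (auto simp: row_def)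
    ultimately have "card {..<4::nat} \<le> card {2..<5::nat}"
      by (metis card_inj_on_le finite_atLeastLessThan)
    then show False by simp
  qed
  then obtain i j where ij: "i < j" "j < 4" "v (i * k + q) = v (j * k + q)" by blast
  have "i * k + q + (j - i) * k = j * k + q"
    using ij(1) by (simp flip: distrib_right)
  then have "v (i * k + q + (j - i) * k) = v (i * k + q)"
    using ij(3) by (simp only:)
  then have dvd: "l dvd (j - i) * k" using v_shift by blast
  have "j - i \<in> {1, 2, 3}" using ij by auto
  then consider "l dvd k" | "l dvd 2 * k" | "l dvd 3 * k" using dvd by auto
  then show False
  proof cases
    case 1 then show ?thesis using l_not_dvd by blast
  next
    case 3
    then have v3: "v (2 * k + k) = v 0" using v_shift[of 0 "3 * k"] by simp
    \<comment> \<open>Three pairwise distinct rows cannot all be 0 or 1.\<close>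
    have "row m (v 0) \<noteq> row m (v k)" "row m (v k) \<noteq> row m (v (2 * k))"
      "row m (v (2 * k)) \<noteq> row m (v 0)"
      using row_alt[of 0] row_alt[of 1] row_alt[of 2] v3 by (simp_all add: mult_2)
    then show ?thesis
      using row_y[of 0] row_y[of 1] row_y[of 2] by simp
  next
    case 2
    then have v2: "v (k + k) = v 0" using v_shift[of 0 "2 * k"] by (simp add: mult_2)
    define X where "X = Max (T 0)"
    define X' where "X' = Max (T k)"
    have fin: "finite (T i)" "T i \<noteq> {}" for i
      using card_T[of i] k by (auto intro!: card_ge_0_finite)
    have X: "X \<in> T 0" "X' \<in> T k"
      using fin Max_in unfolding X_def X'_def by blast+
    have zz: "[v (k + q) = v q] (mod m)" using z_cong[of 1] by simp
    \<comment> \<open>Since \<open>v (2 * k) = v 0\<close>, each of \<open>v 0\<close> and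
      \<open>v k\<close> satisfies the congruence with both tails \<open>T 0\<close> and
      \<open>T k\<close>. Their rows are 0 and 1 in some order, so \<open>X\<close> and
      \<open>X'\<close> agree in both codes modulo \<open>m\<close>.\<close>
    have c: "[v 0 + code m (row m (v 0)) X = v q] (mod m)"
      "[v k + code m (row m (v k)) X = v q] (mod m)"
      "[v k + code m (row m (v k)) X' = v (k + q)] (mod m)"
      "[v 0 + code m (row m (v 0)) X' = v (k + q)] (mod m)"
      using round(4,5)[of 0] round(4,5)[of 1] v2 unfolding X_def X'_def by simp_all
    have "[code m (row m (v 0)) X = code m (row m (v 0)) X'] (mod m)"
      using c(1,4) zz by (metis cong_add_lcancel_nat cong_sym cong_trans)
    moreover have "[code m (row m (v k)) X = code m (row m (v k)) X'] (mod m)"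
      using c(2,3) zz by (metis cong_add_lcancel_nat cong_sym cong_trans)
    moreover have "row m (v 0) < 2" "row m (v k) < 2" "row m (v 0) \<noteq> row m (v k)"
      using row_y[of 0] row_y[of 1] row_alt[of 0] by auto
    then have "row m (v 0) = 0 \<and> row m (v k) = 1 \<or> row m (v 0) = 1 \<and> row m (v k) = 0" by linarith
    ultimately have "[code m 0 X = code m 0 X'] (mod m)" "[code m 1 X = code m 1 X'] (mod m)"
      by auto
    moreover have "X \<in> v ` {0..<0 + k}" "X' \<in> v ` {k..<k + k}"
      using X unfolding window by auto
    then obtain i j where ij: "X = v i" "X' = v j" "i < k" "k \<le> j" "j < k + k" by auto
    ultimately have "X = X'"
      using code_inject v_less by metis
    then have vij: "l dvd j - i"
      using ij mod_eq_dvd_iff_nat[of i j l] by (auto simp: v_eq_iff)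
    have "i \<noteq> 0"
    proof
      assume "i = 0"
      then have "X = y 0" using ij(1) y0 by simp
      then show False using X(1) pointed_notin(2)[OF pointed[of 0]] by simp
    qed
    \<comment> \<open>From \<open>k < l\<close> the quotient is 1, so \<open>l = 2 * k\<close> and
      the windows at 0 and \<open>k\<close> are disjoint, which excludes the common vertex
      \<open>X\<close>.\<close>
    obtain a where a: "2 * k = l * a" using 2 by blast
    have "l * a < l * 2" using a k by linarith
    then have "a < 2" by simp
    then have l: "l = 2 * k" using a k by (cases "a = 0") auto
    have "j - i > 0" using ij by simp
    then have "l \<le> j - i" using vij dvd_imp_le by blast
    then show ?thesis using l ij \<open>i \<noteq> 0\<close> by linarith
  qed
qed

end

text \<open>Restarting the walk at the position \<open>p\<close> of \<open>y 0\<close> reduces to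
  \<open>contradiction_at_zero\<close>, because that vertex is still the \<open>y\<close> of the
  window at \<open>p\<close>.\<close>

lemma (in tight_cycle_walk) impossible: False
proof -
  obtain p where p: "y 0 = v p" "p < k"
    using window[of 0] by (metis add_0 atLeastLessThan_iff imageE insertCI)
  have yp: "y p = v p"
    using keep_y[of 0 p p] p by simp
  interpret shifted: tight_cycle_walk m k l
    "\<lambda>i. v (i + p)" "\<lambda>i. y (i + p)" "\<lambda>i. z (i + p)" "\<lambda>i. T (i + p)"
  proof
    show "(\<lambda>i. v (i + p)) ` {i..<i + k} = insert (y (i + p)) (insert (z (i + p)) (T (i + p)))" for i
    proof -
      have "(\<lambda>i. v (i + p)) ` {i..<i + k} = v ` (\<lambda>i. i + p) ` {i..<i + k}"
        by (simp only: image_image)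
      also have "(\<lambda>i. i + p) ` {i..<i + k} = {i + p..<i + p + k}"
        by (simp only: image_add_atLeastLessThan' add.assoc add.commute[of k])
      finally show ?thesis by (simp only: window)
    qed
    show "v (i + p) = v (j + p) \<longleftrightarrow> i mod l = j mod l" for i j
      using cong_add_rcancel_nat[of i p j l] by (simp add: v_eq_iff cong_def)
  qed (rule linked v_less k card_T)+
  show False using shifted.contradiction_at_zero yp by simp
qed

section \<open>The hypergraph and the absence of tight cycles\<close>

definition linked_edges :: "nat \<Rightarrow> nat \<Rightarrow> nat \<Rightarrow> nat set set" where
  "linked_edges m t k = {insert y (insert z T) | y z T.
     linked m y z T \<and> insert y (insert z T) \<subseteq> {..<5 * m * t} \<and> card T = k - 2}"

lemma linked_edges_card:
  assumes "e \<in> linked_edges m t k" "3 \<le> k"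
  shows "card e = k"
proof -
  obtain y z T where e: "e = insert y (insert z T)" "linked m y z T" "card T = k - 2"
    using assms(1) unfolding linked_edges_def by blast
  have "finite T"
    using e(3) assms(2) by (intro card_ge_0_finite) simp
  then show ?thesis
    using e pointed_notin[of "block m" "\<lambda>v. row m v < 2" y z T] assms(2)
    unfolding linked_def by simp
qed

text \<open>The bound \<open>5 * t \<le> m\<close> keeps the vertices of edges below
  \<open>m * m\<close>, where two codes determine \<open>Max T\<close>. Leaving \<open>V\<close>
  free allows vertices outside the blocks.\<close>

lemma linked_edges_tight_cycle_free:
  assumes k: "3 \<le> k" and m: "5 * t \<le> m"
  shows "tight_cycle_free k (V, linked_edges m t k)"
  unfolding tight_cycle_free_def
proof
  assume "\<exists>l H'. l \<ge> k + 1 \<and> subhypergraph H' (V, linked_edges m t k) \<and>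
    hypergraph_iso (tight_cycle k l) H'"
  then obtain l H' where lH: "k + 1 \<le> l" "subhypergraph H' (V, linked_edges m t k)"
    "hypergraph_iso (tight_cycle k l) H'" by blast
  have l: "k < l" and sub: "edges H' \<subseteq> linked_edges m t k"
    using lH(1,2) unfolding subhypergraph_def by simp_all
  obtain f where f: "bij_betw f {..<l} (vertices H')"
      "(\<lambda>e. f ` e) ` {{(i + j) mod l | j. j < k} | i. i < l} = edges H'"
    using lH(3) unfolding hypergraph_iso_def tight_cycle_def fst_conv snd_conv by blast
  define v where "v i = f (i mod l)" for i
  have window: "v ` {i..<i + k} \<in> linked_edges m t k" for i
  proof -
    have "v ` {i..<i + k} = f ` {(i mod l + j) mod l | j. j < k}"
    proof -
      have "{i..<i + k} = (\<lambda>j. i + j) ` {..<k}"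
        by (simp add: lessThan_atLeast0 add.commute)
      then show ?thesis
        unfolding v_def by (auto simp: mod_add_left_eq)
    qed
    also have "\<dots> \<in> edges H'"
      unfolding f(2)[symmetric] using l by (intro imageI CollectI exI[of _ "i mod l"]) simp
    finally show ?thesis using sub by blast
  qed
  then have "\<forall>i. \<exists>y z T. v ` {i..<i + k} = insert y (insert z T) \<and> linked m y z T \<and>
      insert y (insert z T) \<subseteq> {..<5 * m * t} \<and> card T = k - 2"
    unfolding linked_edges_def by blast
  then obtain y z T where yzT: "\<And>i. v ` {i..<i + k} = insert (y i) (insert (z i) (T i)) \<and>
      linked m (y i) (z i) (T i) \<and> insert (y i) (insert (z i) (T i)) \<subseteq> {..<5 * m * t} \<and>
      card (T i) = k - 2"
    by metis
  interpret tight_cycle_walk m k l v y z T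
  proof
    show "v i = v j \<longleftrightarrow> i mod l = j mod l" for i j
      using inj_onD[OF bij_betw_imp_inj_on[OF f(1)]] l unfolding v_def by auto
    show "v i < m * m" for i
    proof -
      have "v i \<in> v ` {i..<i + k}" using k by simp
      then have "v i < 5 * m * t" using yzT[of i] by auto
      also have "\<dots> \<le> m * m" using mult_le_mono1[OF m, of m] by (simp add: mult_ac)
      finally show ?thesis .
    qed
  qed (use yzT k l in auto)
  show False by (rule impossible)
qed

section \<open>Counting the edges\<close>

lemma block_row:
  assumes "e < 5" "d < m"
  shows "block m (5 * m * a + e * m + d) = a" "row m (5 * m * a + e * m + d) = e"
proof -
  have "5 * m * a + e * m + d = d + (5 * a + e) * m"
    by (simp add: algebra_simps)
  then have "(5 * m * a + e * m + d) div m = 5 * a + e"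
    using assms(2) by simp
  then show "block m (5 * m * a + e * m + d) = a" "row m (5 * m * a + e * m + d) = e"
    using assms(1) unfolding block_def row_def by simp_all
qed

text \<open>Given a block \<open>a\<close> and a tail above it, choose one of \<open>3 * m\<close>
  places \<open>r\<close> for \<open>z\<close> and one of two rows \<open>e\<close> for
  \<open>y\<close>; the congruence then forces the place of \<open>y\<close> in its row.\<close>

lemma card_linked_edges:
  assumes m: "0 < m"
  shows "(\<Sum>a<t. 6 * m * ((5 * m * (t - Suc a)) choose (k - 2))) \<le> card (linked_edges m t k)"
proof -
  define tails where "tails a = {T. T \<subseteq> {5 * m * Suc a..<5 * m * t} \<and> card T = k - 2}" for a
  define A where "A = (SIGMA a:{..<t}. tails a \<times> {..<3 * m} \<times> {..<2::nat})"
  \<comment> \<open>Adding \<open>(m - 1) * h\<close> subtracts \<open>h\<close> modulo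
    \<open>m\<close> within the naturals.\<close>
  define ypos where "ypos a T r e =
    5 * m * a + e * m + (r + (m - 1) * code m e (Max T)) mod m" for a T r e
  define zpos where "zpos a r = 5 * m * a + (2 + r div m) * m + r mod m" for a r
  define edge where "edge = (\<lambda>(a, T, r, e). insert (ypos a T r e) (insert (zpos a r) T))"
  have y: "block m (ypos a T r e) = a" "row m (ypos a T r e) = e" if "e < 2" for a T r e
    using block_row[of e "_ mod m" m a] that m unfolding ypos_def by simp_all
  have z: "block m (zpos a r) = a" "row m (zpos a r) = 2 + r div m" if "r < 3 * m" for a r
  proof -
    have "2 + r div m < 5" using that by (simp add: less_mult_imp_div_less)
    then show "block m (zpos a r) = a" "row m (zpos a r) = 2 + r div m"
      using block_row[of "2 + r div m" "r mod m" m a] m unfolding zpos_def by simp_all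
  qed
  have linked: "linked m (ypos a T r e) (zpos a r) T"
    if T: "T \<in> tails a" and r: "r < 3 * m" and e: "e < 2" for a T r e
  proof -
    have "a < block m u" if "u \<in> T" for u
    proof -
      have "5 * m * Suc a \<le> u" using T that unfolding tails_def by auto
      then have "(5 * Suc a) * m div m \<le> u div m" by (intro div_le_mono) (simp add: mult_ac)
      then have "5 * Suc a div 5 \<le> u div m div 5" using m by (intro div_le_mono) simp
      then show ?thesis unfolding block_def by simp
    qed
    moreover have "[ypos a T r e + code m e (Max T) = zpos a r] (mod m)"
    proof -
      define h where "h = code m e (Max T)"
      have "ypos a T r e = (5 * a + e) * m + (r + (m - 1) * h) mod m"
        unfolding ypos_def h_def by (simp add: algebra_simps)
      then have "[ypos a T r e = r + (m - 1) * h] (mod m)"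
        unfolding cong_def by (simp only: mod_mult_self3 mod_mod_trivial)
      then have "[ypos a T r e + h = r + (m - 1) * h + h] (mod m)"
        by (rule cong_add[OF _ cong_refl])
      also have "r + (m - 1) * h + h = r + m * h"
        using m by (cases m) simp_all
      also have "[r + m * h = zpos a r] (mod m)"
      proof -
        have "zpos a r = (5 * a + 2 + r div m) * m + r mod m"
          unfolding zpos_def by (simp add: algebra_simps)
        then have "zpos a r mod m = r mod m"
          by (simp only: mod_mult_self3 mod_mod_trivial)
        then show ?thesis unfolding cong_def by simp
      qed
      finally show ?thesis unfolding h_def .
    qed
    ultimately show ?thesis
      using y[OF e] z[OF r] e unfolding linked_def pointed_def by auto
  qed
  have "inj_on edge A"
  proof (rule inj_onI)
    fix u u'
    assume u: "u \<in> A" "u' \<in> A" "edge u = edge u'"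
    obtain a T r e where 1: "u = (a, T, r, e)" by (cases u)
    obtain a' T' r' e' where 2: "u' = (a', T', r', e')" by (cases u')
    note uu = 1 2
    have A: "(a, T, r, e) \<in> A" "(a', T', r', e') \<in> A"
      and eq: "edge (a, T, r, e) = edge (a', T', r', e')"
      using u unfolding uu .
    have mem: "T \<in> tails a" "r < 3 * m" "e < 2" "T' \<in> tails a'" "r' < 3 * m" "e' < 2"
      using A unfolding A_def by auto
    have "linked m (ypos a T r e) (zpos a r) T" "linked m (ypos a' T' r' e') (zpos a' r') T'"
      using linked mem by blast+
    \<comment> \<open>The edge determines \<open>y\<close>, \<open>z\<close> and \<open>T\<close>;
      then \<open>y\<close> yields \<open>a\<close> and \<open>e\<close>, and \<open>z\<close>
      yields \<open>r\<close>.\<close>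
    then have *: "ypos a T r e = ypos a' T' r' e'" "zpos a r = zpos a' r'" "T = T'"
      using pointed_unique eq unfolding linked_def edge_def prod.case by metis+
    have "a = a'" "e = e'"
      using y[OF mem(3)] y[OF mem(6)] *(1) by metis+
    moreover have "r = r'"
      using *(2) \<open>a = a'\<close> unfolding zpos_def add_mult_distrib by simp
    ultimately show "u = u'" using *(3) uu by blast
  qed
  moreover have "edge ` A \<subseteq> linked_edges m t k"
  proof clarify
    fix a T r e assume A: "(a, T, r, e) \<in> A"
    have mem: "a < t" "T \<in> tails a" "r < 3 * m" "e < 2"
      using A unfolding A_def by auto
    have "5 * m * a + 5 * m \<le> 5 * m * t"
      using mult_le_mono2[of "Suc a" t "5 * m"] mem(1) by simp
    moreover have "ypos a T r e < 5 * m * a + 5 * m"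
    proof -
      have "e * m \<le> 1 * m" using mem(4) by (intro mult_le_mono1) simp
      moreover have "(r + (m - 1) * code m e (Max T)) mod m < m" using m by simp
      ultimately show ?thesis unfolding ypos_def by linarith
    qed
    moreover have "zpos a r < 5 * m * a + 5 * m"
      using mem(3) unfolding zpos_def add_mult_distrib by simp
    ultimately have "insert (ypos a T r e) (insert (zpos a r) T) \<subseteq> {..<5 * m * t}" "card T = k - 2"
      using mem(2) unfolding tails_def by auto
    then show "edge (a, T, r, e) \<in> linked_edges m t k"
      using linked[OF mem(2,3,4)] unfolding linked_edges_def edge_def by blast
  qed
  moreover have "finite (linked_edges m t k)"
    by (rule finite_subset[of _ "Pow {..<5 * m * t}"]) (auto simp: linked_edges_def)
  ultimately have "card A \<le> card (linked_edges m t k)"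
    by (rule card_inj_on_le)
  moreover have "card A = (\<Sum>a<t. 6 * m * ((5 * m * (t - Suc a)) choose (k - 2)))"
  proof -
    have "card (tails a) = (5 * m * (t - Suc a)) choose (k - 2)" for a
      unfolding tails_def using n_subsets[of "{5 * m * Suc a..<5 * m * t}" "k - 2"]
      by (simp add: diff_mult_distrib2)
    moreover have "finite (tails a)" for a
      unfolding tails_def by (rule finite_subset[of _ "Pow {..<5 * m * t}"]) auto
    ultimately show ?thesis
      unfolding A_def by (simp add: card_cartesian_product mult_ac)
  qed
  ultimately show ?thesis by simp
qed

section \<open>Binomial estimates and the final bound\<close>

text \<open>Each of \<open>B\<close> uses of Pascal's rule adds at most
  \<open>(M + B) choose p\<close>.\<close>

lemma choose_add_le: "(M + B) choose Suc p \<le> (M choose Suc p) + B * ((M + B) choose p)"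
proof (induction B)
  case (Suc B)
  have mono: "(M + B) choose p \<le> Suc (M + B) choose p"
    by (rule binomial_right_mono) simp
  then have "B * ((M + B) choose p) \<le> B * (Suc (M + B) choose p)"
    by (rule mult_le_mono2)
  with mono Suc have "((M + B) choose p) + ((M + B) choose Suc p) \<le>
      (M choose Suc p) + ((Suc (M + B) choose p) + B * (Suc (M + B) choose p))"
    by linarith
  then show ?case by simp
qed simp

text \<open>Each added block is bounded by its upper end; shifting the index to match the count of
  tails costs only the last term.\<close>

lemma choose_le_sum_blocks:
  "(B * t) choose Suc p \<le> (\<Sum>b<t. B * ((B * b) choose p)) + B * ((B * t) choose p)"
proof (induction t)
  case (Suc t)
  have "(B * Suc t) choose Suc p \<le> ((B * t) choose Suc p) + B * ((B * Suc t) choose p)"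
    using choose_add_le[of "B * t" B p] by (simp add: add_ac)
  then show ?case using Suc by simp
qed simp

theorem theorem1p1:
  fixes k :: nat
  assumes "k \<ge> 3"
  shows "\<exists>c::real. c > 0 \<and>
    (\<exists>N::nat. \<forall>n\<ge>N. real (max_tight_cycle_free k n) \<ge> (1 + c) * real ((n - 1) choose (k - 1)))"
proof -
  \<comment> \<open>A row length \<open>m\<close> takes \<open>m * s\<close> vertices, so
    \<open>m = n div s\<close> leaves fewer than \<open>s\<close> over. The factor 24 is chosen to
    make the error below at most a twelfth.\<close>
  define p r t s where "p = k - 2" and "r = Suc p" and "t = 24 * r" and "s = 5 * t"
  have k: "k - 1 = r" "k - 2 = p" "p < r"
    using assms unfolding p_def r_def by auto
  have "real (max_tight_cycle_free k n) \<ge> (1 + 1/10) * real ((n - 1) choose (k - 1))"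
    if n: "n \<ge> s * s" for n
  proof -
    define m where "m = n div s"
    have "s > 0" unfolding s_def t_def r_def by simp
    then have ms: "s \<le> m"
      using n unfolding m_def by (simp add: less_eq_div_iff_mult_less_eq)
    define B N where "B = 5 * m" and "N = B * t"
    have N: "N \<le> n" "n \<le> N + s"
    proof -
      have "N = m * s" unfolding N_def B_def s_def by simp
      moreover have "n = m * s + n mod s" unfolding m_def by simp
      moreover have "n mod s < s" using \<open>s > 0\<close> by simp
      ultimately show "N \<le> n" "n \<le> N + s" by linarith+
    qed
    define E where "E = linked_edges m t k"
    define S where "S = (\<Sum>b<t. B * ((B * b) choose p))"
    define C D where "C = (N + s) choose r" and "D = (N + s) choose p"
    have "C \<le> (N choose r) + s * D"
      unfolding C_def D_def r_def by (rule choose_add_le)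
    also have "N choose r \<le> S + B * (N choose p)"
      unfolding S_def N_def r_def by (rule choose_le_sum_blocks)
    also have "N choose p \<le> D"
      unfolding D_def by (rule binomial_right_mono) simp
    finally have C: "C \<le> S + (B + s) * D"
      by (simp add: algebra_simps)
    \<comment> \<open>By absorption \<open>(N + s - p) * D = r * C\<close>, so this bounds the error
      \<open>(B + s) * D\<close> by a twelfth of \<open>C\<close>.\<close>
    have "12 * r * (B + s) \<le> N + s - p"
    proof -
      have "12 * r * s \<le> 12 * r * B" using ms unfolding B_def by (intro mult_le_mono2) simp
      moreover have "12 * r * (B + s) = 12 * r * B + 12 * r * s" by (rule distrib_left)
      moreover have "N = 24 * r * B" unfolding N_def t_def by simp
      moreover have "p \<le> s" unfolding s_def t_def r_def by simp
      ultimately show ?thesis by linarith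
    qed
    then have "12 * r * (B + s) * D \<le> (N + s - p) * D"
      by (rule mult_le_mono1)
    also have "\<dots> = r * C"
      unfolding C_def D_def r_def
      using binomial_absorb_comp[of "N + s" p] binomial_absorption[of p "N + s"] by simp
    finally have "r * (12 * ((B + s) * D)) \<le> r * C"
      by (simp add: mult_ac)
    then have "12 * ((B + s) * D) \<le> C"
      unfolding r_def by (simp only: mult_le_cancel1)
    then have "11 * C \<le> 12 * S" using C by linarith
    \<comment> \<open>A tail has \<open>6 * m\<close> edges against weight \<open>B = 5 * m\<close>
      in \<open>S\<close>. The product of 11/12 and 6/5 is 11/10, hence the constant 1/10.\<close>
    moreover have "6 * S \<le> 5 * card E"
    proof -
      have "6 * S = 5 * (\<Sum>b<t. 6 * m * ((B * b) choose p))"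
        unfolding S_def B_def by (simp add: sum_distrib_left mult_ac)
      also have "(\<Sum>b<t. 6 * m * ((B * b) choose p)) = (\<Sum>a<t. 6 * m * ((B * (t - Suc a)) choose p))"
        by (rule sum.nat_diff_reindex[symmetric])
      also have "\<dots> \<le> card E"
        unfolding E_def B_def using card_linked_edges[of m t k] ms \<open>s > 0\<close> k(2) by simp
      finally show ?thesis by simp
    qed
    moreover have "(n - 1) choose r \<le> C"
      unfolding C_def using N(2) by (intro binomial_right_mono) simp
    moreover have "card E \<le> max_tight_cycle_free k n"
    proof -
      have "e \<subseteq> {..<n}" if "e \<in> E" for e
        using that N(1) unfolding E_def linked_edges_def N_def B_def by fastforce
      then have "uniform_hypergraph k ({..<n}, E)"
        using linked_edges_card assms unfolding uniform_hypergraph_def E_def by auto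
      moreover have "tight_cycle_free k ({..<n}, E)"
        unfolding E_def using linked_edges_tight_cycle_free assms ms unfolding s_def by blast
      ultimately have "card E \<in> edge_counts k n"
        unfolding edge_counts_def by (intro CollectI exI[of _ "({..<n}, E)"]) simp
      then show ?thesis
        unfolding max_tight_cycle_free_def using finite_edge_counts by (rule Max_ge[rotated])
    qed
    ultimately have "11 * ((n - 1) choose r) \<le> 10 * max_tight_cycle_free k n"
      by linarith
    then have "real (11 * ((n - 1) choose r)) \<le> real (10 * max_tight_cycle_free k n)"
      by (simp only: of_nat_le_iff)
    then show ?thesis
      unfolding k(1) by simp
  qed
  then show ?thesis
    by (intro exI[of _ "1/10::real"]) auto
qed

end
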